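(* For every real $\lambda \ge 0.7983$, every real $x\ge 2$, and every $2$-primitive set $A$, \[ \sum_{\substack{n \in A\\ n\le x}} \frac{1}{n^\lambda} \;\le\; \sum_{\substack{p \in \mathcal{P}(A)\\ p\le x}} \frac{1}{p^\lambda}. \]
   Context: A set $A$ of integers greater than $1$ with $|A|\ge 3$ is called $2$-primitive if no element of $A$ divides the product of $2$ distinct other elements of $A$. $\mathcal{P}(A)$ denotes the set of primes dividing some member of $A$; $p$ runs over primes. *)

theory Defs
  imports Complex_Main "HOL-Computational_Algebra.Primes"
begin

text \<open>The set may be infinite, and \<^const>\<open>card\<close> is 0 on infinite sets, so the
  cardinality condition is only imposed on finite sets.\<close>

definition two_primitive :: "nat set \<Rightarrow> bool" where
  "two_primitive A \<longleftrightarrow>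
     (\<forall>a\<in>A. 1 < a) \<and>
     (finite A \<longrightarrow> 3 \<le> card A) \<and>
     (\<forall>a\<in>A. \<forall>b\<in>A. \<forall>c\<in>A. a \<noteq> b \<and> a \<noteq> c \<and> b \<noteq> c \<longrightarrow> \<not> a dvd b * c)"

definition primes_dividing :: "nat set \<Rightarrow> nat set" where
  "primes_dividing A = {p. prime p \<and> (\<exists>a\<in>A. p dvd a)}"

end

theory Submission imports Defs begin

text \<open>
  A divisor of \<open>n \<in> A\<close> is private if it divides no other element of \<open>A\<close>. In a 2-primitive
  set, whenever \<open>n = u v\<close> with \<open>u, v\<close> coprime, one of \<open>u, v\<close> is private. Each \<open>n\<close> is charged to one
  of its primes \<open>q\<close> as follows. If some full prime power \<open>q\<^sup>e\<close> of \<open>n\<close> is private, charge \<open>n\<close> to \<open>q\<close>;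
  this happens at most once for each \<open>q\<close>. Otherwise let \<open>u\<close> be the least divisor of \<open>n\<close> with
  \<open>gcd(u, n/u) = 1\<close> and \<open>u\<^sup>3 \<ge> n\<close>; this yields \<open>n = c d\<close> with \<open>d\<close> private, not a prime power,
  and \<open>d \<le> c\<^sup>2\<close>. Charge \<open>n\<close> to the largest prime \<open>q\<close> of \<open>d\<close>. As \<open>d\<close> determines \<open>n\<close> and
  \<open>n \<ge> d powr (3/2)\<close>, the sum of \<open>n powr -\<lambda>\<close> over the second kind of charges is at most the sum
  of \<open>d powr (-3\<lambda>/2)\<close> over all \<open>d\<close> with largest prime \<open>q\<close> other than the powers of \<open>q\<close>, an Euler
  product. Numerically, this leaves enough room below \<open>q powr -\<lambda>\<close> for the possible charge of the
  first kind, whose \<open>n\<close> is then a multiple of \<open>q\<^sup>2\<close>: either \<open>n \<ge> 2 q\<^sup>2\<close>, or \<open>n = q\<^sup>2\<close> and there is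
  just one charge of the second kind.
\<close>

section \<open>Private divisors\<close>

definition private_divisor :: "nat set \<Rightarrow> nat \<Rightarrow> nat \<Rightarrow> bool" where
  "private_divisor A n d \<longleftrightarrow> d dvd n \<and> (\<forall>b\<in>A. b \<noteq> n \<longrightarrow> \<not> d dvd b)"

definition mixed_with_top :: "nat \<Rightarrow> nat set" where
  "mixed_with_top q = {d. d > 0 \<and> q dvd d \<and> (\<forall>p. prime p \<and> p dvd d \<longrightarrow> p \<le> q)
                         \<and> (\<exists>p<q. prime p \<and> p dvd d)}"

text \<open>The condition \<open>d \<le> c\<^sup>2\<close> is equivalent to d^3 <= n^2 for n = c d >
  0; this is what turns n powr -lam into at most d powr -(3 lam / 2).\<close>

definition balanced_charge :: "nat set \<Rightarrow> nat \<Rightarrow> nat \<Rightarrow> nat \<Rightarrow> bool" where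
  "balanced_charge A q n d \<longleftrightarrow> d \<in> mixed_with_top q \<and> private_divisor A n d
     \<and> (\<exists>c. n = c * d \<and> coprime c d \<and> d \<le> c\<^sup>2)"

text \<open>The cardinality condition enters here: it supplies a third element c, and a | b would
  give the forbidden a | b c. Infinite sets are covered, since a subset of {a, b} is finite.\<close>

lemma two_primitive_not_dvd:
  assumes A: "two_primitive A" and ab: "a \<in> A" "b \<in> A" "a \<noteq> b"
  shows "\<not> a dvd b"
proof
  assume "a dvd b"
  have "\<not> A \<subseteq> {a, b}"
  proof
    assume sub: "A \<subseteq> {a, b}"
    then have "finite A" by (rule finite_subset) simp
    moreover have "card A \<le> 2" using card_mono[OF _ sub] ab by simp
    ultimately show False using A by (auto simp: two_primitive_def)
  qed
  then obtain c where "c \<in> A" "c \<noteq> a" "c \<noteq> b" by blast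
  moreover have "a dvd b * c" using \<open>a dvd b\<close> by simp
  ultimately show False using A ab unfolding two_primitive_def by metis
qed

text \<open>If neither part were private, u | b and v | c for some other elements b, c. Then u v
  divides b c when b and c differ, and divides b itself by coprimality when they agree; both are
  excluded.\<close>

lemma private_divisor_of_coprime_split:
  assumes A: "two_primitive A" and n: "u * v \<in> A" and cop: "coprime u v"
  shows "private_divisor A (u * v) u \<or> private_divisor A (u * v) v"
proof (rule ccontr)
  assume "\<not> ?thesis"
  then obtain b c where b: "b \<in> A" "b \<noteq> u * v" "u dvd b" and c: "c \<in> A" "c \<noteq> u * v" "v dvd c"
    by (auto simp: private_divisor_def)
  show False
  proof (cases "b = c")
    case True
    then have "u * v dvd b" using b c cop by (simp add: divides_mult)
    then show False using two_primitive_not_dvd[OF A n] b by blast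
  next
    case False
    have "u * v dvd b * c" using b c by (simp add: mult_dvd_mono)
    moreover have "\<not> u * v dvd b * c"
      using A n b(1,2) c(1,2) False unfolding two_primitive_def by metis
    ultimately show False by blast
  qed
qed

text \<open>If d had only one prime p, coprimality with c would make d the full power of p in n,
  which is not private. If d = 1 were private, n would be the only element of A and every divisor of
  n would be private vacuously.\<close>

lemma private_divisor_two_primes:
  assumes n: "n > 1" and nopp: "\<And>p. prime p \<Longrightarrow> p dvd n \<Longrightarrow> \<not> private_divisor A n (p ^ multiplicity p n)"
    and cd: "n = c * d" "coprime c d" and priv: "private_divisor A n d"
  shows "\<exists>p r. prime p \<and> prime r \<and> p < r \<and> p dvd d \<and> r dvd d"
proof -
  have "d \<noteq> 1"
  proof
    assume "d = 1"
    then have "A \<subseteq> {n}" using priv by (auto simp: private_divisor_def)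
    moreover obtain p where "prime p" "p dvd n" using n prime_factor_nat by (metis less_irrefl)
    ultimately show False using nopp[of p] by (auto simp: private_divisor_def multiplicity_dvd)
  qed
  then obtain p where p: "prime p" "p dvd d" using prime_factor_nat by blast
  have d0: "d > 0" using n cd by (cases d) auto
  show ?thesis
  proof (rule ccontr)
    assume "\<not> ?thesis"
    then have only: "r = p" if "prime r" "r dvd d" for r
      using that p by (metis linorder_neqE_nat)
    define w where "w = d div p ^ multiplicity p d"
    have d: "d = p ^ multiplicity p d * w" by (simp add: w_def multiplicity_dvd)
    have "\<not> p dvd w" unfolding w_def using p d0 by (intro multiplicity_decompose) (auto simp: prime_nat_iff)
    then have "w = 1" using only d by (metis dvd_mult prime_factor_nat)
    then have dp: "d = p ^ multiplicity p d" using d by simp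
    have "\<not> p dvd c" using p cd(2) by (metis coprime_common_divisor not_prime_unit)
    then have "multiplicity p n = multiplicity p d"
      using cd p multiplicity_prime_elem_times_other[of p c d] by (simp add: prime_imp_prime_elem)
    then show False using nopp[of p] p dp priv cd by (metis dvd_mult)
  qed
qed

text \<open>Take u minimal with u^3 >= n among the divisors coprime to their cofactor v. If v is
  private, v <= u^2 suffices. Otherwise u is private and has two primes, so u = Q w with Q, w > 1
  coprime. Minimality gives Q^3 < n and w^3 < n, hence u^3 < n^2, hence n < v^3 and u <= v^2: the
  roles of u and v are exchanged.\<close>

lemma exists_balanced_private_divisor:
  assumes A: "two_primitive A" and n: "n \<in> A"
    and nopp: "\<And>p. prime p \<Longrightarrow> p dvd n \<Longrightarrow> \<not> private_divisor A n (p ^ multiplicity p n)"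
  shows "\<exists>c d. n = c * d \<and> coprime c d \<and> d \<le> c\<^sup>2 \<and> private_divisor A n d"
proof -
  have n1: "n > 1" using A n by (auto simp: two_primitive_def)
  define U where "U = (\<lambda>u. \<exists>v. n = u * v \<and> coprime u v \<and> n \<le> u ^ 3)"
  have "U n" unfolding U_def using n1 by (intro exI[of _ 1]) (auto simp: power3_eq_cube)
  define u where "u = (LEAST u. U u)"
  have "U u" unfolding u_def by (rule LeastI) fact
  then obtain v where v: "n = u * v" "coprime u v" "n \<le> u ^ 3" by (auto simp: U_def)
  have least: "u \<le> w" if "U w" for w unfolding u_def using that by (rule Least_le)
  have uv0: "u > 0" "v > 0" using v n1 by (auto intro!: Nat.gr0I)
  have vu: "v \<le> u\<^sup>2" using v uv0 by (simp add: power3_eq_cube power2_eq_square)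
  show ?thesis
  proof (cases "private_divisor A n v")
    case True
    then show ?thesis using v vu by blast
  next
    case False
    then have priv: "private_divisor A n u"
      using private_divisor_of_coprime_split[OF A, of u v] n v by simp
    then obtain p r where p: "prime p" "p dvd u" and r: "prime r" "r dvd u" "p < r"
      using private_divisor_two_primes[OF n1 nopp, of v u] v by (auto simp: mult.commute coprime_commute)
    define Q where "Q = p ^ multiplicity p u"
    define w where "w = u div Q"
    have u: "u = Q * w" by (simp add: Q_def w_def multiplicity_dvd)
    have npw: "\<not> p dvd w" unfolding w_def Q_def using p uv0 by (intro multiplicity_decompose) (auto simp: prime_nat_iff)
    then have cQw: "coprime Q w" unfolding Q_def
      using p by (simp add: prime_imp_coprime coprime_power_left_iff)
    have "multiplicity p u > 0" using p uv0 by (simp add: prime_multiplicity_gt_zero_iff)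
    then have Q1: "Q > 1" using p prime_gt_1_nat[of p] unfolding Q_def by (intro one_less_power) auto
    have "r dvd w"
    proof -
      have "\<not> r dvd Q" using p r unfolding Q_def by (metis prime_dvd_power primes_dvd_imp_eq less_irrefl)
      then show ?thesis using r u by (metis prime_dvd_mult_iff)
    qed
    moreover have "w > 0" using u uv0 by (cases w) auto
    ultimately have w1: "w > 1" using r prime_gt_1_nat[of r] by (metis dvd_imp_le order_less_le_trans)
    have cv: "coprime Q v" "coprime w v" using v(2) u by (auto simp: coprime_mult_left_iff)
    have "\<not> U Q" using least[of Q] u Q1 w1 by auto
    moreover have "n = Q * (w * v)" "coprime Q (w * v)" using v(1) u cQw cv by (auto simp: coprime_mult_right_iff)
    ultimately have Q3: "Q ^ 3 < n" unfolding U_def using not_le by blast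
    have "\<not> U w" using least[of w] u Q1 w1 by auto
    moreover have "n = w * (Q * v)" "coprime w (Q * v)" using v(1) u cQw cv by (auto simp: coprime_mult_right_iff coprime_commute)
    ultimately have w3: "w ^ 3 < n" unfolding U_def using not_le by blast
    have "u ^ 3 < n * n" using Q3 w3 by (simp add: u power_mult_distrib mult_strict_mono)
    then have "u ^ 3 * n < n * n * n" using n1 by simp
    also have "\<dots> = u ^ 3 * v ^ 3" by (simp add: v(1) power3_eq_cube ac_simps)
    finally have "n < v ^ 3" using uv0 by simp
    then have "u \<le> v\<^sup>2" using v(1) uv0 by (simp add: power3_eq_cube power2_eq_square)
    then show ?thesis using v priv by (metis mult.commute coprime_commute)
  qed
qed

lemma exists_charged_prime:
  assumes A: "two_primitive A" and n: "n \<in> A"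
  shows "\<exists>q. prime q \<and> q dvd n \<and>
           (private_divisor A n (q ^ multiplicity q n) \<or> (\<exists>d. balanced_charge A q n d))"
proof (cases "\<exists>q. prime q \<and> q dvd n \<and> private_divisor A n (q ^ multiplicity q n)")
  case True then show ?thesis by blast
next
  case False
  then have nopp: "\<And>p. prime p \<Longrightarrow> p dvd n \<Longrightarrow> \<not> private_divisor A n (p ^ multiplicity p n)" by blast
  have n1: "n > 1" using A n by (auto simp: two_primitive_def)
  obtain c d where cd: "n = c * d" "coprime c d" "d \<le> c\<^sup>2" "private_divisor A n d"
    using exists_balanced_private_divisor[OF A n nopp] by blast
  obtain p r where pr: "prime p" "prime r" "p < r" "p dvd d" "r dvd d"
    using private_divisor_two_primes[OF n1 nopp cd(1,2,4)] by blast
  have d0: "d > 0" using n1 cd by (cases d) auto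
  define q where "q = Max (prime_factors d)"
  have rq: "r \<in> prime_factors d" using pr d0 by (auto simp: in_prime_factors_iff)
  then have q: "q \<in> prime_factors d" unfolding q_def by (intro Max_in) auto
  have le: "t \<le> q" if "prime t" "t dvd d" for t
    unfolding q_def using that d0 by (intro Max_ge) (auto simp: in_prime_factors_iff)
  \<comment> \<open>The largest prime of d is at least r > p, so p witnesses that d is not a power
    of q.\<close>
  have "p < q" using le[of r] pr by simp
  then have "balanced_charge A q n d"
    using cd q d0 le pr by (auto simp: balanced_charge_def mixed_with_top_def in_prime_factors_iff)
  moreover have "prime q" "q dvd n" using q cd by (auto simp: in_prime_factors_iff)
  ultimately show ?thesis by blast
qed

section \<open>Sums over smooth numbers\<close>

text \<open>Mapping d to the pair (exponent of r, cofactor) is injective and the summand is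
  multiplicative, so the sum is at most a product over a full rectangle. The exponents contribute at
  most a geometric series from k on: k = 0 serves the Euler product, k = 1 the case where r must
  divide d.\<close>

lemma sum_powr_split_prime:
  fixes D :: "nat set" and s :: real
  assumes fin: "finite D" and r: "prime r" and s: "s > 0"
    and D: "\<And>d. d \<in> D \<Longrightarrow> d > 0 \<and> k \<le> multiplicity r d"
  shows "(\<Sum>d\<in>D. real d powr - s)
       \<le> (real r powr - s) ^ k / (1 - real r powr - s)
         * (\<Sum>m\<in>(\<lambda>d. d div r ^ multiplicity r d) ` D. real m powr - s)"
proof -
  define g where "g = (\<lambda>d. (multiplicity r d, d div r ^ multiplicity r d))"
  define M where "M = (\<lambda>d. d div r ^ multiplicity r d) ` D"
  define J where "J = multiplicity r ` D"
  define x where "x = real r powr - s"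
  have r1: "r > 1" using r prime_gt_1_nat by blast
  have x01: "0 < x" "x < 1"
    using r1 s unfolding x_def by (simp_all add: powr_less_one)
  have rec: "d = r ^ multiplicity r d * (d div r ^ multiplicity r d)" for d
    by (simp add: multiplicity_dvd)
  have inj: "inj_on g D"
    unfolding g_def by (rule inj_onI) (metis prod.inject rec)
  have val: "real d powr - s = x ^ fst (g d) * real (snd (g d)) powr - s" if "d \<in> D" for d
  proof -
    have "real d = real r ^ multiplicity r d * real (d div r ^ multiplicity r d)"
      using arg_cong[OF rec[of d], of real] by (simp only: of_nat_mult of_nat_power)
    then have "real d powr - s = (real r ^ multiplicity r d) powr - s * real (d div r ^ multiplicity r d) powr - s"
      by (simp add: powr_mult)
    also have "(real r ^ multiplicity r d) powr - s = x ^ multiplicity r d"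
      using r1 by (simp add: x_def powr_powr mult.commute flip: powr_realpow)
    finally show ?thesis by (simp add: g_def)
  qed
  have finJ: "finite J" "finite M" using fin by (auto simp: J_def M_def)
  \<comment> \<open>Inserting k keeps the maximum meaningful, and at least k, when J is
    empty.\<close>
  have Jk: "J \<subseteq> {k..Max (insert k J)}"
    using D finJ by (auto simp: J_def intro!: Max_ge)
  have "(\<Sum>d\<in>D. real d powr - s) = (\<Sum>(j, m)\<in>g ` D. x ^ j * real m powr - s)"
    by (subst sum.reindex[OF inj]) (auto intro!: sum.cong simp: val case_prod_unfold)
  also have "\<dots> \<le> (\<Sum>(j, m)\<in>J \<times> M. x ^ j * real m powr - s)"
    using finJ x01 by (intro sum_mono2) (auto simp: g_def J_def M_def)
  also have "\<dots> = (\<Sum>j\<in>J. x ^ j) * (\<Sum>m\<in>M. real m powr - s)"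
    by (simp add: sum_product sum.cartesian_product)
  also have "\<dots> \<le> x ^ k / (1 - x) * (\<Sum>m\<in>M. real m powr - s)"
  proof (intro mult_right_mono sum_nonneg)
    have "(\<Sum>j\<in>J. x ^ j) \<le> (\<Sum>j\<in>{k..Max (insert k J)}. x ^ j)"
      using Jk x01 by (intro sum_mono2) auto
    also have "\<dots> = (x ^ k - x ^ Suc (Max (insert k J))) / (1 - x)"
      using x01 finJ by (subst sum_gp) (auto simp: Max_ge)
    also have "\<dots> \<le> x ^ k / (1 - x)"
      using x01 by (intro divide_right_mono) auto
    finally show "(\<Sum>j\<in>J. x ^ j) \<le> x ^ k / (1 - x)" .
  qed auto
  finally show ?thesis by (simp add: x_def M_def)
qed

lemma prime_factors_div_power_multiplicity:
  fixes d r :: nat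
  assumes "d > 0" "prime r"
  shows "prime_factors (d div r ^ multiplicity r d) = prime_factors d - {r}"
    and "d div r ^ multiplicity r d > 0"
proof -
  define m where "m = d div r ^ multiplicity r d"
  have d: "d = r ^ multiplicity r d * m" by (simp add: m_def multiplicity_dvd)
  have m0: "m > 0" using assms d by (metis gr0I mult_0_right)
  then show "d div r ^ multiplicity r d > 0" by (simp add: m_def)
  have nr: "\<not> r dvd m"
    unfolding m_def using assms by (intro multiplicity_decompose) (auto simp: prime_nat_iff)
  have "p \<in> prime_factors m \<longleftrightarrow> p \<in> prime_factors d - {r}" for p
  proof
    assume "p \<in> prime_factors m"
    then show "p \<in> prime_factors d - {r}"
      using nr d assms by (metis DiffI dvd_mult gr0_implies_Suc in_prime_factors_iff nat.simps(3) singletonD)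
  next
    assume p: "p \<in> prime_factors d - {r}"
    then have "p dvd r ^ multiplicity r d * m" "prime p" using d by (auto simp: in_prime_factors_iff)
    then have "p dvd m" using p assms
      by (metis DiffE insertI1 prime_dvd_mult_iff prime_dvd_power primes_dvd_imp_eq)
    then show "p \<in> prime_factors m" using m0 \<open>prime p\<close> by (auto simp: in_prime_factors_iff)
  qed
  then show "prime_factors (d div r ^ multiplicity r d) = prime_factors d - {r}"
    unfolding m_def[symmetric] by blast
qed

text \<open>Induction on R removes one prime at a time: the cofactors after stripping r have all
  their primes in the smaller set.\<close>

lemma sum_powr_le_euler_product:
  fixes M :: "nat set" and s :: real
  assumes "finite R" "finite M" "s > 0" "\<And>r. r \<in> R \<Longrightarrow> prime r"
    and "\<And>m. m \<in> M \<Longrightarrow> m > 0 \<and> prime_factors m \<subseteq> R"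
  shows "(\<Sum>m\<in>M. real m powr - s) \<le> (\<Prod>r\<in>R. 1 / (1 - real r powr - s))"
  using assms
proof (induction R arbitrary: M rule: finite_induct)
  case empty
  then have "m = 1" if "m \<in> M" for m
    using that by (metis gr_implies_not_zero prime_factorization_empty_iff set_mset_eq_empty_iff
        nat_dvd_1_iff_1 subset_empty)
  then have "M \<subseteq> {1}" by blast
  then have "M = {} \<or> M = {1}" by blast
  then show ?case by auto
next
  case (insert r R)
  let ?M = "(\<lambda>d. d div r ^ multiplicity r d) ` M"
  have r: "prime r" using insert by simp
  then have r1: "real r > 1" using prime_gt_1_nat by auto
  have "real r powr - s < 1" using r1 insert.prems by (simp add: powr_less_one)
  moreover have "(\<Sum>m\<in>?M. real m powr - s) \<le> (\<Prod>r\<in>R. 1 / (1 - real r powr - s))"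
    using insert.prems prime_factors_div_power_multiplicity[OF _ r]
    by (intro insert.IH) blast+
  ultimately have "1 / (1 - real r powr - s) * (\<Sum>m\<in>?M. real m powr - s)
      \<le> 1 / (1 - real r powr - s) * (\<Prod>r\<in>R. 1 / (1 - real r powr - s))"
    by (intro mult_left_mono) auto
  moreover have "(\<Sum>m\<in>M. real m powr - s)
      \<le> (real r powr - s) ^ 0 / (1 - real r powr - s) * (\<Sum>m\<in>?M. real m powr - s)"
    using insert.prems r by (intro sum_powr_split_prime) auto
  ultimately show ?case using insert by simp
qed

text \<open>Integral comparison: by the mean value theorem each term is at most a difference of
  values of x powr (1 - s) / (s - 1), and these differences telescope.\<close>

lemma sum_powr_le_zeta_tail:
  fixes M :: "nat set" and s :: real
  assumes fin: "finite M" and s: "s > 1" and M: "\<And>m. m \<in> M \<Longrightarrow> m \<ge> 2"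
  shows "(\<Sum>m\<in>M. real m powr - s) \<le> 1 / (s - 1)"
proof -
  have step: "real (Suc m) powr - s \<le> (real m powr (1 - s) - real (Suc m) powr (1 - s)) / (s - 1)"
    if m: "m \<ge> 1" for m
  proof -
    have "\<exists>z. real m < z \<and> z < real (Suc m) \<and>
        real (Suc m) powr (1 - s) - real m powr (1 - s) = (real (Suc m) - real m) * ((1 - s) * z powr (1 - s - 1))"
      using m by (intro MVT2 has_real_derivative_powr) auto
    then obtain z where z: "real m < z" "z < real (Suc m)"
      "real (Suc m) powr (1 - s) - real m powr (1 - s) = (1 - s) * z powr - s" by auto
    have "real (Suc m) powr - s \<le> z powr - s"
      using z m s by (intro powr_mono2') auto
    then have "(s - 1) * real (Suc m) powr - s \<le> (s - 1) * z powr - s" using s by simp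
    also have "\<dots> = real m powr (1 - s) - real (Suc m) powr (1 - s)" using z(3) by (simp add: algebra_simps)
    finally show ?thesis using s by (simp add: field_simps)
  qed
  have part: "(\<Sum>m=2..n. real m powr - s) \<le> (1 - real n powr (1 - s)) / (s - 1)" if "n \<ge> 1" for n
    using that
  proof (induction n rule: nat_induct_at_least)
    case base then show ?case by simp
  next
    case (Suc n)
    have "(\<Sum>m=2..Suc n. real m powr - s) = (\<Sum>m=2..n. real m powr - s) + real (Suc n) powr - s"
      using Suc by simp
    also have "\<dots> \<le> (1 - real n powr (1 - s)) / (s - 1)
        + (real n powr (1 - s) - real (Suc n) powr (1 - s)) / (s - 1)"
      using Suc step[of n] by linarith
    finally show ?case by (simp add: add_divide_distrib[symmetric])
  qed
  define n where "n = Max (insert 1 M)"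
  have n: "n \<ge> 1" "M \<subseteq> {2..n}"
    using fin M by (auto simp: n_def intro: Max_ge)
  have "(\<Sum>m\<in>M. real m powr - s) \<le> (\<Sum>m=2..n. real m powr - s)"
    using n by (intro sum_mono2) auto
  also have "\<dots> \<le> (1 - real n powr (1 - s)) / (s - 1)" using part n by blast
  also have "\<dots> \<le> 1 / (s - 1)" using s by (intro divide_right_mono) auto
  finally show ?thesis .
qed

section \<open>Numerical bounds\<close>

text \<open>A fraction just below \<open>0.7983\<close> with a small denominator; \<open>s0\<close> is \<open>3/2\<close> times it.\<close>

definition lam0 :: real where "lam0 = 91 / 114"
definition s0 :: real where "s0 = 91 / 76"

text \<open>Raising to the power b turns a bound on a rational power into an inequality between
  integer powers, which plain arithmetic can decide.\<close>

lemma powr_neg_le_of_power_le: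
  fixes x c :: real
  assumes "x > 0" "c \<ge> 0" "b > 0" "1 \<le> c ^ b * x ^ a"
  shows "x powr - (real a / real b) \<le> c"
proof -
  have "(x powr - (real a / real b)) ^ b = x powr - real a"
    using assms by (simp add: powr_powr flip: powr_realpow)
  also have "\<dots> = 1 / x ^ a" using assms by (simp add: powr_minus powr_realpow divide_inverse)
  also have "\<dots> \<le> c ^ b" using assms by (simp add: field_simps)
  finally show ?thesis using assms by (subst (asm) power_mono_iff) auto
qed

lemma powr_neg_ge_of_power_le:
  fixes x c :: real
  assumes "x > 0" "c \<ge> 0" "b > 0" "c ^ b * x ^ a \<le> 1"
  shows "c \<le> x powr - (real a / real b)"
proof -
  have "c ^ b \<le> 1 / x ^ a" using assms by (simp add: field_simps)
  also have "\<dots> = x powr - real a" using assms by (simp add: powr_minus powr_realpow divide_inverse)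
  also have "\<dots> = (x powr - (real a / real b)) ^ b"
    using assms by (simp add: powr_powr flip: powr_realpow)
  finally show ?thesis using assms by (subst (asm) power_mono_iff) auto
qed

text \<open>Since \<open>91/76 = 7/4 * 13/19\<close>, numerical bounds for \<open>x powr - s0\<close> go through an
  approximation \<open>y / M\<close> of \<open>x powr (7/4)\<close>; this keeps the integers involved small.\<close>

lemma powr_neg_s0_le:
  fixes x y M c N :: real
  assumes "x > 0" "y > 0" "M > 0" "c \<ge> 0" "N > 0" "y ^ 4 \<le> M ^ 4 * x ^ 7" "N ^ 19 * M ^ 13 \<le> c ^ 19 * y ^ 13"
  shows "x powr - s0 \<le> c / N"
proof -
  have "x powr - (7 / 4) \<le> M / y"
    using powr_neg_le_of_power_le[of x "M / y" 4 7] assms by (simp add: field_simps)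
  then have "(x powr - (7 / 4)) powr (13 / 19) \<le> (M / y) powr (13 / 19)"
    by (intro powr_mono2) auto
  also have "\<dots> = (y / M) powr - (13 / 19)"
    using assms by (simp add: powr_minus_divide powr_divide)
  also have "\<dots> \<le> c / N"
    using powr_neg_le_of_power_le[of "y / M" "c / N" 19 13] assms by (simp add: field_simps)
  finally show ?thesis by (simp add: powr_powr s0_def)
qed

lemma powr_neg_s0_ge:
  fixes x y M c N :: real
  assumes "x > 0" "y > 0" "M > 0" "c \<ge> 0" "N > 0" "M ^ 4 * x ^ 7 \<le> y ^ 4" "c ^ 19 * y ^ 13 \<le> N ^ 19 * M ^ 13"
  shows "c / N \<le> x powr - s0"
proof -
  have "c / N \<le> (y / M) powr - (13 / 19)"
    using powr_neg_ge_of_power_le[of "y / M" "c / N" 19 13] assms by (simp add: field_simps)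
  also have "\<dots> = (M / y) powr (13 / 19)"
    using assms by (simp add: powr_minus_divide powr_divide)
  also have "\<dots> \<le> (x powr - (7 / 4)) powr (13 / 19)"
    using powr_neg_ge_of_power_le[of x "M / y" 4 7] assms by (intro powr_mono2) (simp_all add: field_simps)
  finally show ?thesis by (simp add: powr_powr s0_def)
qed

text \<open>Since \<open>lam0\<close> is two thirds of \<open>s0\<close>, the exponent
  \<open>lam0 - s0\<close> is -s0/3 and -lam0 is -2 s0/3. One table of values of x powr - s0 thus
  yields all three powers through a cube root and a square.\<close>

lemma powr_lam0_minus_s0_eq: "x powr (lam0 - s0) = (x powr - s0) powr (1 / 3)"
  by (simp add: powr_powr lam0_def s0_def)

lemma powr_lam0_minus_s0_le:
  fixes x a t :: real
  assumes "x powr - s0 \<le> t" "t \<le> a ^ 3" "0 \<le> a"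
  shows "x powr (lam0 - s0) \<le> a"
proof -
  have "(x powr - s0) powr (1 / 3) \<le> (a ^ 3) powr (1 / 3)" using assms by (intro powr_mono2) auto
  also have "\<dots> = a" using assms by (cases "a = 0") (simp_all add: powr_powr flip: powr_numeral)
  finally show ?thesis by (simp add: powr_lam0_minus_s0_eq)
qed

lemma powr_lam0_minus_s0_ge:
  fixes x a t :: real
  assumes "t \<le> x powr - s0" "a ^ 3 \<le> t" "0 \<le> a"
  shows "a \<le> x powr (lam0 - s0)"
proof -
  have "a = (a ^ 3) powr (1 / 3)" using assms by (cases "a = 0") (simp_all add: powr_powr flip: powr_numeral)
  also have "\<dots> \<le> (x powr - s0) powr (1 / 3)" using assms by (intro powr_mono2) auto
  finally show ?thesis by (simp add: powr_lam0_minus_s0_eq)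
qed

lemma powr_neg_lam0_eq: "x powr - lam0 = (x powr (lam0 - s0)) ^ 2"
  using powr_add[of x "lam0 - s0" "lam0 - s0"] by (simp add: lam0_def s0_def power2_eq_square)

text \<open>A bound for an infinite series of smooth numbers, phrased through finite partial sums.
  The number 1 is left out, so G is the Euler product minus 1.\<close>

definition smooth_sum_bound :: "nat \<Rightarrow> real \<Rightarrow> bool" where
  "smooth_sum_bound q G \<longleftrightarrow> (\<forall>M. finite M \<and> (\<forall>m\<in>M. m \<ge> 2 \<and> (\<forall>p. prime p \<and> p dvd m \<longrightarrow> p < q))
      \<longrightarrow> (\<Sum>m\<in>M. real m powr - s0) \<le> G)"

text \<open>Smoothness is ignored: 76/15 is 1 / (s0 - 1). This crude bound is good enough once q >=
  67.\<close>

lemma smooth_sum_bound_zeta: "smooth_sum_bound q (76 / 15)"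
  unfolding smooth_sum_bound_def using sum_powr_le_zeta_tail[of _ s0] by (auto simp: s0_def)

lemma smooth_sum_bound_euler:
  assumes "finite R" "\<And>r. r \<in> R \<Longrightarrow> prime r" "\<And>p. prime p \<Longrightarrow> p < q \<Longrightarrow> p \<in> R"
    and le: "(\<Prod>r\<in>R. 1 / (1 - real r powr - s0)) \<le> G + 1"
  shows "smooth_sum_bound q G"
  unfolding smooth_sum_bound_def
proof (intro allI impI, elim conjE)
  fix M assume fin: "finite M" and M: "\<forall>m\<in>M. m \<ge> 2 \<and> (\<forall>p. prime p \<and> p dvd m \<longrightarrow> p < q)"
  have "1 \<notin> M" using M by auto
  then have "(\<Sum>m\<in>insert 1 M. real m powr - s0) = 1 + (\<Sum>m\<in>M. real m powr - s0)"
    using fin by simp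
  moreover have "(\<Sum>m\<in>insert 1 M. real m powr - s0) \<le> (\<Prod>r\<in>R. 1 / (1 - real r powr - s0))"
    using assms fin M by (intro sum_powr_le_euler_product) (auto simp: s0_def in_prime_factors_iff)
  ultimately show "(\<Sum>m\<in>M. real m powr - s0) \<le> G" using le by linarith
qed

text \<open>One step of the table of Euler products; replacing e / (1 - t) by a short fraction e'
  above it keeps the numbers from growing.\<close>

lemma euler_product_insert:
  assumes prod: "(\<Prod>r\<in>R. 1 / (1 - real r powr - s0)) \<le> e" "finite R" "r \<notin> R"
    and t: "real r powr - s0 \<le> t" "t < 1" "e \<le> e' * (1 - t)" "0 \<le> e"
  shows "(\<Prod>r\<in>insert r R. 1 / (1 - real r powr - s0)) \<le> e'"
proof -
  have pos: "0 < 1 - real r powr - s0" using t by linarith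
  have "1 / (1 - real r powr - s0) * (\<Prod>r\<in>R. 1 / (1 - real r powr - s0)) \<le> 1 / (1 - real r powr - s0) * e"
    using prod pos by (intro mult_left_mono) auto
  also have "\<dots> \<le> 1 / (1 - t) * e"
    using t pos by (intro mult_right_mono divide_left_mono mult_pos_pos) auto
  also have "\<dots> \<le> e'" using t by (simp add: pos_divide_le_eq)
  finally show ?thesis using prod by simp
qed

lemma prime_less_67:
  assumes "prime p" "p < 67"
  shows "p \<in> {2, 3, 5, 7, 11, 13, 17, 19, 23, 29, 31, 37, 41, 43, 47, 53, 59, 61 :: nat}"
proof (rule ccontr)
  assume out: "\<not> ?thesis"
  \<comment> \<open>Trial division by 2, 3, 5, 7 is enough because 67 < 11^2.\<close>
  have "\<not> r dvd p" if "r \<in> {2, 3, 5, 7}" for r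
  proof -
    have "prime r" using that by auto
    then show ?thesis using that out assms(1) primes_dvd_imp_eq[of r p] by blast
  qed
  then have "\<not> 2 dvd p" "\<not> 3 dvd p" "\<not> 5 dvd p" "\<not> 7 dvd p" by blast+
  moreover have "p \<in> {..<67}" "p \<noteq> 1" using assms by auto
  ultimately show False using out by (auto simp: lessThan_nat_numeral lessThan_Suc)
qed

section \<open>Numerical values of x powr - s0 at small integers\<close>

lemma powr_neg_s0_le_2: "2 powr - s0 \<le> 43613 / 100000"
  \<comment> \<open>In this table y / 1000 approximates x powr (7/4), from below for the upper
    bounds and from above for the lower bounds.\<close>
  by (rule powr_neg_s0_le[where y = 3363 and M = 1000]) simp_all

lemma powr_neg_s0_le_3: "3 powr - s0 \<le> 26837 / 100000"
  by (rule powr_neg_s0_le[where y = 6838 and M = 1000]) simp_all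

lemma powr_neg_s0_le_5: "5 powr - s0 \<le> 14558 / 100000"
  by (rule powr_neg_s0_le[where y = 16718 and M = 1000]) simp_all

lemma powr_neg_s0_le_6: "6 powr - s0 \<le> 11703 / 100000"
  by (rule powr_neg_s0_le[where y = 23001 and M = 1000]) simp_all

lemma powr_neg_s0_le_7: "7 powr - s0 \<le> 9731 / 100000"
  by (rule powr_neg_s0_le[where y = 30124 and M = 1000]) simp_all

lemma powr_neg_s0_le_10: "10 powr - s0 \<le> 6349 / 100000"
  by (rule powr_neg_s0_le[where y = 56234 and M = 1000]) simp_all

lemma powr_neg_s0_le_11: "11 powr - s0 \<le> 5664 / 100000"
  by (rule powr_neg_s0_le[where y = 66441 and M = 1000]) simp_all

lemma powr_neg_s0_le_13: "13 powr - s0 \<le> 4637 / 100000"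
  by (rule powr_neg_s0_le[where y = 89002 and M = 1000]) simp_all

lemma powr_neg_s0_le_14: "14 powr - s0 \<le> 4244 / 100000"
  by (rule powr_neg_s0_le[where y = 101326 and M = 1000]) simp_all

lemma powr_neg_s0_le_17: "17 powr - s0 \<le> 3363 / 100000"
  by (rule powr_neg_s0_le[where y = 142326 and M = 1000]) simp_all

lemma powr_neg_s0_le_19: "19 powr - s0 \<le> 2944 / 100000"
  by (rule powr_neg_s0_le[where y = 172909 and M = 1000]) simp_all

lemma powr_neg_s0_le_23: "23 powr - s0 \<le> 2342 / 100000"
  by (rule powr_neg_s0_le[where y = 241559 and M = 1000]) simp_all

lemma powr_neg_s0_le_29: "29 powr - s0 \<le> 1775 / 100000"
  by (rule powr_neg_s0_le[where y = 362406 and M = 1000]) simp_all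

lemma powr_neg_s0_le_31: "31 powr - s0 \<le> 1639 / 100000"
  by (rule powr_neg_s0_le[where y = 407270 and M = 1000]) simp_all

lemma powr_neg_s0_le_36: "36 powr - s0 \<le> 1370 / 100000"
  by (rule powr_neg_s0_le[where y = 529089 and M = 1000]) simp_all

lemma powr_neg_s0_le_37: "37 powr - s0 \<le> 1326 / 100000"
  by (rule powr_neg_s0_le[where y = 555076 and M = 1000]) simp_all

lemma powr_neg_s0_le_41: "41 powr - s0 \<le> 1173 / 100000"
  by (rule powr_neg_s0_le[where y = 664311 and M = 1000]) simp_all

lemma powr_neg_s0_le_43: "43 powr - s0 \<le> 1108 / 100000"
  by (rule powr_neg_s0_le[where y = 722054 and M = 1000]) simp_all

lemma powr_neg_s0_le_47: "47 powr - s0 \<le> 996 / 100000"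
  by (rule powr_neg_s0_le[where y = 843667 and M = 1000]) simp_all

lemma powr_neg_s0_le_53: "53 powr - s0 \<le> 863 / 100000"
  by (rule powr_neg_s0_le[where y = 1041076 and M = 1000]) simp_all

lemma powr_neg_s0_le_59: "59 powr - s0 \<le> 759 / 100000"
  by (rule powr_neg_s0_le[where y = 1256003 and M = 1000]) simp_all

lemma powr_neg_s0_le_67: "67 powr - s0 \<le> 652 / 100000"
  by (rule powr_neg_s0_le[where y = 1569028 and M = 1000]) simp_all

lemma powr_neg_s0_ge_2: "43603 / 100000 \<le> 2 powr - s0"
  by (rule powr_neg_s0_ge[where y = 3364 and M = 1000]) simp_all

lemma powr_neg_s0_ge_4: "19015 / 100000 \<le> 4 powr - s0"
  by (rule powr_neg_s0_ge[where y = 11314 and M = 1000]) simp_all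

lemma powr_neg_s0_ge_5: "14556 / 100000 \<le> 5 powr - s0"
  by (rule powr_neg_s0_ge[where y = 16719 and M = 1000]) simp_all

lemma powr_neg_s0_ge_7: "9729 / 100000 \<le> 7 powr - s0"
  by (rule powr_neg_s0_ge[where y = 30125 and M = 1000]) simp_all

section \<open>Euler products over the primes up to 59\<close>

lemma euler_product_2: "(\<Prod>r\<in>{2}. 1 / (1 - real r powr - s0)) \<le> 3547 / 2000"
  by (rule euler_product_insert[where R = "{}" and e = 1 and t = "43613 / 100000"])
    (use powr_neg_s0_le_2 in simp_all)

lemma euler_product_3: "(\<Prod>r\<in>{3, 2}. 1 / (1 - real r powr - s0)) \<le> 24241 / 10000"
  by (rule euler_product_insert[OF euler_product_2, where t = "26837 / 100000"])
    (use powr_neg_s0_le_3 in simp_all)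

lemma euler_product_5: "(\<Prod>r\<in>{5, 3, 2}. 1 / (1 - real r powr - s0)) \<le> 7093 / 2500"
  by (rule euler_product_insert[OF euler_product_3, where t = "14558 / 100000"])
    (use powr_neg_s0_le_5 in simp_all)

lemma euler_product_7: "(\<Prod>r\<in>{7, 5, 3, 2}. 1 / (1 - real r powr - s0)) \<le> 31431 / 10000"
  by (rule euler_product_insert[OF euler_product_5, where t = "9731 / 100000"])
    (use powr_neg_s0_le_7 in simp_all)

lemma euler_product_11: "(\<Prod>r\<in>{11, 7, 5, 3, 2}. 1 / (1 - real r powr - s0)) \<le> 33319 / 10000"
  by (rule euler_product_insert[OF euler_product_7, where t = "5664 / 100000"])
    (use powr_neg_s0_le_11 in simp_all)

lemma euler_product_13: "(\<Prod>r\<in>{13, 11, 7, 5, 3, 2}. 1 / (1 - real r powr - s0)) \<le> 1747 / 500"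
  by (rule euler_product_insert[OF euler_product_11, where t = "4637 / 100000"])
    (use powr_neg_s0_le_13 in simp_all)

lemma euler_product_17: "(\<Prod>r\<in>{17, 13, 11, 7, 5, 3, 2}. 1 / (1 - real r powr - s0)) \<le> 9039 / 2500"
  by (rule euler_product_insert[OF euler_product_13, where t = "3363 / 100000"])
    (use powr_neg_s0_le_17 in simp_all)

lemma euler_product_19: "(\<Prod>r\<in>{19, 17, 13, 11, 7, 5, 3, 2}. 1 / (1 - real r powr - s0)) \<le> 37253 / 10000"
  by (rule euler_product_insert[OF euler_product_17, where t = "2944 / 100000"])
    (use powr_neg_s0_le_19 in simp_all)

lemma euler_product_23: "(\<Prod>r\<in>{23, 19, 17, 13, 11, 7, 5, 3, 2}. 1 / (1 - real r powr - s0)) \<le> 38147 / 10000"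
  by (rule euler_product_insert[OF euler_product_19, where t = "2342 / 100000"])
    (use powr_neg_s0_le_23 in simp_all)

lemma euler_product_29: "(\<Prod>r\<in>{29, 23, 19, 17, 13, 11, 7, 5, 3, 2}. 1 / (1 - real r powr - s0)) \<le> 38837 / 10000"
  by (rule euler_product_insert[OF euler_product_23, where t = "1775 / 100000"])
    (use powr_neg_s0_le_29 in simp_all)

lemma euler_product_31: "(\<Prod>r\<in>{31, 29, 23, 19, 17, 13, 11, 7, 5, 3, 2}. 1 / (1 - real r powr - s0)) \<le> 7897 / 2000"
  by (rule euler_product_insert[OF euler_product_29, where t = "1639 / 100000"])
    (use powr_neg_s0_le_31 in simp_all)

lemma euler_product_37: "(\<Prod>r\<in>{37, 31, 29, 23, 19, 17, 13, 11, 7, 5, 3, 2}. 1 / (1 - real r powr - s0)) \<le> 2501 / 625"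
  by (rule euler_product_insert[OF euler_product_31, where t = "1326 / 100000"])
    (use powr_neg_s0_le_37 in simp_all)

lemma euler_product_41: "(\<Prod>r\<in>{41, 37, 31, 29, 23, 19, 17, 13, 11, 7, 5, 3, 2}. 1 / (1 - real r powr - s0)) \<le> 40491 / 10000"
  by (rule euler_product_insert[OF euler_product_37, where t = "1173 / 100000"])
    (use powr_neg_s0_le_41 in simp_all)

lemma euler_product_43: "(\<Prod>r\<in>{43, 41, 37, 31, 29, 23, 19, 17, 13, 11, 7, 5, 3, 2}. 1 / (1 - real r powr - s0)) \<le> 8189 / 2000"
  by (rule euler_product_insert[OF euler_product_41, where t = "1108 / 100000"])
    (use powr_neg_s0_le_43 in simp_all)

lemma euler_product_47: "(\<Prod>r\<in>{47, 43, 41, 37, 31, 29, 23, 19, 17, 13, 11, 7, 5, 3, 2}. 1 / (1 - real r powr - s0)) \<le> 41357 / 10000"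
  by (rule euler_product_insert[OF euler_product_43, where t = "996 / 100000"])
    (use powr_neg_s0_le_47 in simp_all)

lemma euler_product_53: "(\<Prod>r\<in>{53, 47, 43, 41, 37, 31, 29, 23, 19, 17, 13, 11, 7, 5, 3, 2}. 1 / (1 - real r powr - s0)) \<le> 20859 / 5000"
  by (rule euler_product_insert[OF euler_product_47, where t = "863 / 100000"])
    (use powr_neg_s0_le_53 in simp_all)

lemma euler_product_59: "(\<Prod>r\<in>{59, 53, 47, 43, 41, 37, 31, 29, 23, 19, 17, 13, 11, 7, 5, 3, 2}. 1 / (1 - real r powr - s0)) \<le> 21019 / 5000"
  by (rule euler_product_insert[OF euler_product_53, where t = "759 / 100000"])
    (use powr_neg_s0_le_59 in simp_all)

section \<open>Bounds for the charges of the second kind to one prime\<close>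

lemma sum_mixed_with_top_le:
  assumes q: "prime q" and fin: "finite D" and D: "D \<subseteq> mixed_with_top q" and G: "smooth_sum_bound q G"
  shows "(\<Sum>d\<in>D. real d powr - s0) \<le> real q powr - s0 / (1 - real q powr - s0) * G"
proof -
  let ?M = "(\<lambda>d. d div q ^ multiplicity q d) ` D"
  have q1: "real q > 1" using q prime_gt_1_nat by auto
  have lt1: "real q powr - s0 < 1" using q1 by (simp add: powr_less_one s0_def)
  have "(\<Sum>d\<in>D. real d powr - s0)
      \<le> (real q powr - s0) ^ 1 / (1 - real q powr - s0) * (\<Sum>m\<in>?M. real m powr - s0)"
  proof (rule sum_powr_split_prime[OF fin q])
    fix d assume "d \<in> D"
    then have "d > 0" "q dvd d" using D by (auto simp: mixed_with_top_def)
    then show "d > 0 \<and> 1 \<le> multiplicity q d"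
      using q by (simp add: Suc_le_eq prime_multiplicity_gt_zero_iff)
  qed (simp add: s0_def)
  also have "\<dots> \<le> (real q powr - s0) ^ 1 / (1 - real q powr - s0) * G"
  proof (rule mult_left_mono)
    \<comment> \<open>Stripping the power of q leaves the smaller prime p of d in m, so m is not 1,
      while all primes of m are now below q.\<close>
    have "m \<ge> 2 \<and> (\<forall>p. prime p \<and> p dvd m \<longrightarrow> p < q)" if m: "m \<in> ?M" for m
    proof -
      obtain d where d: "d \<in> D" "m = d div q ^ multiplicity q d" using m by blast
      then have d0: "d > 0" and top: "\<forall>p. prime p \<and> p dvd d \<longrightarrow> p \<le> q" and "\<exists>p<q. prime p \<and> p dvd d"
        using D by (auto simp: mixed_with_top_def)
      then obtain p where p: "p < q" "prime p" "p dvd d" by blast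
      have pf: "prime_factors m = prime_factors d - {q}" and m0: "m > 0"
        using prime_factors_div_power_multiplicity[OF d0 q] d by auto
      have "p \<in> prime_factors m" unfolding pf using p d0 by (auto simp: in_prime_factors_iff)
      then have "p dvd m" by (simp add: in_prime_factors_iff)
      then have "m \<ge> 2" using m0 p(2) by (meson dvd_imp_le order_trans prime_ge_2_nat)
      moreover have "r < q" if "prime r" "r dvd m" for r
      proof -
        have "r \<in> prime_factors m" using that m0 by (simp add: in_prime_factors_iff)
        then show ?thesis unfolding pf using top by (auto simp: in_prime_factors_iff le_neq_implies_less)
      qed
      ultimately show ?thesis by blast
    qed
    then show "(\<Sum>m\<in>?M. real m powr - s0) \<le> G"
      by (intro G[unfolded smooth_sum_bound_def, THEN spec, THEN mp] conjI[OF finite_imageI[OF fin] ballI])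
  qed (use lt1 in auto)
  finally show ?thesis by simp
qed

text \<open>From d <= c^2 follows d^3 <= c^2 d^2 = n^2; raise this to the power -lam0/2.\<close>

lemma ratio_powr_lam0_le:
  assumes n: "n = c * d" and cd: "d \<le> c\<^sup>2" and d0: "d > 0"
  shows "(real q / real n) powr lam0 \<le> real q powr lam0 * real d powr - s0"
proof -
  have c0: "c > 0" using cd d0 by (auto intro!: Nat.gr0I)
  have "real d ^ 3 \<le> real n ^ 2"
  proof -
    have "d ^ 3 = d * d\<^sup>2" by (simp add: power3_eq_cube power2_eq_square)
    also have "\<dots> \<le> c\<^sup>2 * d\<^sup>2" using cd by (rule mult_right_mono) simp
    finally have "d ^ 3 \<le> n\<^sup>2" by (simp add: n power_mult_distrib)
    then show ?thesis by (metis of_nat_le_iff of_nat_power)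
  qed
  then have "(real n ^ 2) powr - (lam0 / 2) \<le> (real d ^ 3) powr - (lam0 / 2)"
    using d0 by (intro powr_mono2') (auto simp: lam0_def)
  moreover have "real n ^ 2 = real n powr 2" "real d ^ 3 = real d powr 3"
    using n c0 d0 by simp_all
  ultimately have "real n powr - lam0 \<le> real d powr - s0"
    by (simp only: powr_powr) (simp add: lam0_def s0_def)
  then have "real q powr lam0 * real n powr - lam0 \<le> real q powr lam0 * real d powr - s0"
    by (intro mult_left_mono) auto
  moreover have "(real q / real n) powr lam0 = real q powr lam0 * real n powr - lam0"
    by (simp add: powr_divide powr_minus_divide)
  ultimately show ?thesis by simp
qed

text \<open>The set \<open>S\<close> collects small values of \<open>d\<close>, for which coprimality forces \<open>c\<close> to be
  noticeably larger than \<open>sqrt d\<close>.\<close>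

lemma balanced_sum_le:
  assumes q: "prime q" and fin: "finite F" and inj: "inj_on \<delta> F" and G: "smooth_sum_bound q G"
    and F: "\<And>n. n \<in> F \<Longrightarrow> \<delta> n \<in> mixed_with_top q \<and> (\<exists>c. n = c * \<delta> n \<and> \<delta> n \<le> c\<^sup>2)"
    and S: "finite S" "S \<subseteq> mixed_with_top q"
    and e: "\<And>n. n \<in> F \<Longrightarrow> \<delta> n \<in> S \<Longrightarrow> (real q / real n) powr lam0 \<le> e (\<delta> n)"
    and e0: "\<And>d. d \<in> S \<Longrightarrow> 0 \<le> e d"
  shows "(\<Sum>n\<in>F. (real q / real n) powr lam0)
       \<le> real q powr (lam0 - s0) / (1 - real q powr - s0) * G
         - (\<Sum>d\<in>S. real q powr lam0 * real d powr - s0 - e d)"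
proof -
  define w where "w = (\<lambda>d. if d \<in> S then e d else real q powr lam0 * real d powr - s0)"
  \<comment> \<open>Adjoining S makes the saving available for every d in S, whether or not d
    occurs: the extra weights \<open>e d\<close> are nonnegative and only enlarge the sum.\<close>
  let ?D = "\<delta> ` F \<union> S"
  have D: "finite ?D" "?D \<subseteq> mixed_with_top q" using fin S F by auto
  have "(\<Sum>n\<in>F. (real q / real n) powr lam0) \<le> (\<Sum>n\<in>F. w (\<delta> n))"
  proof (rule sum_mono)
    fix n assume n: "n \<in> F"
    then obtain c where "n = c * \<delta> n" "\<delta> n \<le> c\<^sup>2" using F by blast
    moreover have "\<delta> n > 0" using F[OF n] by (simp add: mixed_with_top_def)
    ultimately show "(real q / real n) powr lam0 \<le> w (\<delta> n)"
      using ratio_powr_lam0_le[of n c "\<delta> n" q] e[OF n] by (simp add: w_def)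
  qed
  also have "\<dots> = (\<Sum>d\<in>\<delta> ` F. w d)" by (simp add: sum.reindex[OF inj])
  also have "\<dots> \<le> (\<Sum>d\<in>?D. w d)"
    using D e0 by (intro sum_mono2) (auto simp: w_def)
  also have "\<dots> = (\<Sum>d\<in>?D. real q powr lam0 * real d powr - s0)
      - (\<Sum>d\<in>?D. if d \<in> S then real q powr lam0 * real d powr - s0 - e d else 0)"
    by (subst sum_subtractf[symmetric]) (auto intro!: sum.cong simp: w_def)
  also have "(\<Sum>d\<in>?D. if d \<in> S then real q powr lam0 * real d powr - s0 - e d else 0)
      = (\<Sum>d\<in>S. real q powr lam0 * real d powr - s0 - e d)"
    using D(1) by (simp add: sum.If_cases Int_absorb1)
  also have "(\<Sum>d\<in>?D. real q powr lam0 * real d powr - s0)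
      = real q powr lam0 * (\<Sum>d\<in>?D. real d powr - s0)" by (simp add: sum_distrib_left)
  also have "\<dots> \<le> real q powr lam0 * (real q powr - s0 / (1 - real q powr - s0) * G)"
    using sum_mixed_with_top_le[OF q D G] by (intro mult_left_mono) auto
  also have "\<dots> = real q powr (lam0 - s0) / (1 - real q powr - s0) * G"
    by (simp add: powr_diff powr_minus divide_inverse)
  finally show ?thesis by simp
qed

lemma powr_neg_lam0_le:
  fixes x a t :: real
  assumes "x powr - s0 \<le> t" "t \<le> a ^ 3" "0 \<le> a"
  shows "x powr - lam0 \<le> a\<^sup>2"
  unfolding powr_neg_lam0_eq using powr_lam0_minus_s0_le[OF assms] by (intro power_mono) auto

lemma powr_neg_lam0_le_2: "2 powr - lam0 \<le> 57511 / 100000"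
  using powr_neg_lam0_le[OF powr_neg_s0_le_2, of "75836 / 100000"] by (simp add: power_divide)

text \<open>Both terms decrease in q, so a computation at q0 covers all q >= q0. The second term is
  the room for one charge n >= 2 q^2, for which q / n <= 1 / (2 q).\<close>

lemma balanced_factor_le:
  fixes q0 G :: real
  assumes q: "q0 \<le> real q" "q0 > 1" and G: "G \<ge> 0"
    and b: "q0 powr - s0 \<le> b" "b < 1" and a: "b \<le> a ^ 3" "0 \<le> a"
    and num: "a / (1 - b) * G + 57511 / 100000 * a\<^sup>2 \<le> B"
  shows "real q powr (lam0 - s0) / (1 - real q powr - s0) * G + (1 / (2 * real q)) powr lam0 \<le> B"
proof -
  have qs: "real q powr - s0 \<le> b"
    using q b(1) powr_mono2'[of "- s0" q0 "real q"] by (simp add: s0_def)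
  have "real q powr (lam0 - s0) / (1 - real q powr - s0) \<le> a / (1 - b)"
    using powr_lam0_minus_s0_le[OF qs a] qs b a by (intro frac_le) auto
  then have "real q powr (lam0 - s0) / (1 - real q powr - s0) * G \<le> a / (1 - b) * G"
    using G by (rule mult_right_mono)
  moreover have "(1 / (2 * real q)) powr lam0 \<le> 57511 / 100000 * a\<^sup>2"
  proof -
    have "(1 / (2 * real q)) powr lam0 = 2 powr - lam0 * real q powr - lam0"
      using q by (simp add: powr_divide powr_mult powr_minus_divide)
    also have "\<dots> \<le> 57511 / 100000 * a\<^sup>2"
      using powr_neg_lam0_le_2 powr_neg_lam0_le[OF qs a] by (intro mult_mono) auto
    finally show ?thesis .
  qed
  ultimately show ?thesis using num by linarith
qed

lemma balanced_factor_3: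
  "real 3 powr (lam0 - s0) / (1 - real 3 powr - s0) * (7735 / 10000) + (1 / (2 * real 3)) powr lam0 \<le> 1"
  by (rule balanced_factor_le[OF _ _ _ powr_neg_s0_le_3, where a = "64503 / 100000"])
    (simp_all add: power_divide)

text \<open>For q = 5 and q = 7 the bound exceeds 1, by 0.0360 and 0.0579; the savings below recover
  the excess.\<close>

lemma balanced_factor_5:
  "real 5 powr (lam0 - s0) / (1 - real 5 powr - s0) * (14241 / 10000) + (1 / (2 * real 5)) powr lam0 \<le> 10360 / 10000"
  by (rule balanced_factor_le[OF _ _ _ powr_neg_s0_le_5, where a = "52606 / 100000"])
    (simp_all add: power_divide)

lemma balanced_factor_7:
  "real 7 powr (lam0 - s0) / (1 - real 7 powr - s0) * (18372 / 10000) + (1 / (2 * real 7)) powr lam0 \<le> 10579 / 10000"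
  by (rule balanced_factor_le[OF _ _ _ powr_neg_s0_le_7, where a = "45996 / 100000"])
    (simp_all add: power_divide)

lemma balanced_factor_11:
  "real 11 powr (lam0 - s0) / (1 - real 11 powr - s0) * (21431 / 10000) + (1 / (2 * real 11)) powr lam0 \<le> 1"
  by (rule balanced_factor_le[OF _ _ _ powr_neg_s0_le_11, where a = "38404 / 100000"])
    (simp_all add: power_divide)

lemma balanced_factor_13:
  "real 13 powr (lam0 - s0) / (1 - real 13 powr - s0) * (23319 / 10000) + (1 / (2 * real 13)) powr lam0 \<le> 1"
  by (rule balanced_factor_le[OF _ _ _ powr_neg_s0_le_13, where a = "35927 / 100000"])
    (simp_all add: power_divide)

lemma balanced_factor_17:
  assumes "17 \<le> q"
  shows "real q powr (lam0 - s0) / (1 - real q powr - s0) * (26156 / 10000) + (1 / (2 * real q)) powr lam0 \<le> 1"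
  by (rule balanced_factor_le[OF _ _ _ powr_neg_s0_le_17, where a = "32279 / 100000"])
    (use assms in \<open>simp_all add: power_divide\<close>)

lemma balanced_factor_23:
  assumes "23 \<le> q"
  shows "real q powr (lam0 - s0) / (1 - real q powr - s0) * (32038 / 10000) + (1 / (2 * real q)) powr lam0 \<le> 1"
  by (rule balanced_factor_le[OF _ _ _ powr_neg_s0_le_23, where a = "28611 / 100000"])
    (use assms in \<open>simp_all add: power_divide\<close>)

lemma balanced_factor_67:
  assumes "67 \<le> q"
  shows "real q powr (lam0 - s0) / (1 - real q powr - s0) * (76 / 15) + (1 / (2 * real q)) powr lam0 \<le> 1"
  by (rule balanced_factor_le[OF _ _ _ powr_neg_s0_le_67, where a = "18682 / 100000"])
    (use assms in \<open>simp_all add: power_divide\<close>)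

lemma saving_ge:
  fixes q d k :: nat and a b c :: real
  assumes d: "d = q * k" "q > 0" and a: "0 \<le> a" "a \<le> real q powr (lam0 - s0)" and b: "0 \<le> b" "b \<le> real k powr - s0"
    and c: "real m powr - lam0 \<le> c" and num: "v \<le> a * b - c"
  shows "v \<le> real q powr lam0 * real d powr - s0 - real m powr - lam0"
proof -
  have "real q powr lam0 * real d powr - s0 = real q powr (lam0 - s0) * real k powr - s0"
    by (simp add: d powr_mult powr_diff powr_minus_divide)
  moreover have "a * b \<le> real q powr (lam0 - s0) * real k powr - s0"
    using a b by (intro mult_mono) auto
  ultimately show ?thesis using c num by linarith
qed

text \<open>For q = 5 and d = 10 the cofactor c is at least 7, so n >= 70 = 14 * 5 and the ratio q /
  n is at most 1/14 in place of the generic estimate.\<close>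

lemma saving_10: "1076 / 10000 \<le> real 5 powr lam0 * real 10 powr - s0 - real 14 powr - lam0"
  by (rule saving_ge[where k = 2 and a = "52603 / 100000" and b = "43603 / 100000" and c = "(34882 / 100000)\<^sup>2"])
    (use powr_lam0_minus_s0_ge[OF powr_neg_s0_ge_5, of "52603 / 100000"] powr_neg_s0_ge_2
      powr_neg_lam0_le[OF powr_neg_s0_le_14, of "34882 / 100000"] in \<open>simp_all add: power_divide\<close>)

text \<open>For q = 7, d = 14 forces c >= 5 and n >= 70 = 10 * 7. In \<open>saving_28\<close>, d =
  28 forces c >= 9 and n >= 252 = 36 * 7.\<close>

lemma saving_14: "413 / 10000 \<le> real 7 powr lam0 * real 14 powr - s0 - real 10 powr - lam0"
  by (rule saving_ge[where k = 2 and a = "45992 / 100000" and b = "43603 / 100000" and c = "(39894 / 100000)\<^sup>2"])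
    (use powr_lam0_minus_s0_ge[OF powr_neg_s0_ge_7, of "45992 / 100000"] powr_neg_s0_ge_2
      powr_neg_lam0_le[OF powr_neg_s0_le_10, of "39894 / 100000"] in \<open>simp_all add: power_divide\<close>)

lemma saving_28: "301 / 10000 \<le> real 7 powr lam0 * real 28 powr - s0 - real 36 powr - lam0"
  by (rule saving_ge[where k = 4 and a = "45992 / 100000" and b = "19015 / 100000" and c = "(23929 / 100000)\<^sup>2"])
    (use powr_lam0_minus_s0_ge[OF powr_neg_s0_ge_7, of "45992 / 100000"] powr_neg_s0_ge_4
      powr_neg_lam0_le[OF powr_neg_s0_le_36, of "23929 / 100000"] in \<open>simp_all add: power_divide\<close>)

text \<open>For the case where q^2 itself is charged to q: its ratio is 1/q <= 1/3, and the only
  other charge turns out to be at least 6 q.\<close>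

lemma three_six_powr_le_1: "3 powr - lam0 + 6 powr - lam0 \<le> 1"
  using powr_neg_lam0_le[OF powr_neg_s0_le_3, of "64503 / 100000"] powr_neg_lam0_le[OF powr_neg_s0_le_6, of "48914 / 100000"] by (simp add: power_divide)

text \<open>Each constant is a tabulated Euler product minus 1, taken over the primes below the
  right end of the range of q.\<close>

lemma smooth_sum_bound_prime:
  fixes q :: nat
  shows "q \<le> 3 \<Longrightarrow> smooth_sum_bound q (7735 / 10000)" "q \<le> 5 \<Longrightarrow> smooth_sum_bound q (14241 / 10000)"
    "q \<le> 7 \<Longrightarrow> smooth_sum_bound q (18372 / 10000)" "q \<le> 11 \<Longrightarrow> smooth_sum_bound q (21431 / 10000)"
    "q \<le> 13 \<Longrightarrow> smooth_sum_bound q (23319 / 10000)" "q \<le> 19 \<Longrightarrow> smooth_sum_bound q (26156 / 10000)"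
    "q \<le> 61 \<Longrightarrow> smooth_sum_bound q (32038 / 10000)"
proof -
  have *: "smooth_sum_bound q G"
    if "q \<le> k" "k \<le> 61" "finite R" "\<forall>r\<in>R. prime r" "\<forall>p\<in>{2, 3, 5, 7, 11, 13, 17, 19, 23, 29, 31, 37, 41, 43, 47, 53, 59, 61}. p < k \<longrightarrow> p \<in> R"
      "(\<Prod>r\<in>R. 1 / (1 - real r powr - s0)) \<le> e" "e \<le> G + 1" for k :: nat and R e G
  proof (rule smooth_sum_bound_euler[of R])
    fix p assume p: "prime p" "p < q"
    then have "p < 67" "p < k" using that(1,2) by auto
    then show "p \<in> R" using prime_less_67[OF p(1)] that(5) by blast
  qed (use that in auto)
  show "q \<le> 3 \<Longrightarrow> smooth_sum_bound q (7735 / 10000)"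
    by (rule *[where k = 3, OF _ _ _ _ _ euler_product_2]) simp_all
  show "q \<le> 5 \<Longrightarrow> smooth_sum_bound q (14241 / 10000)"
    by (rule *[where k = 5, OF _ _ _ _ _ euler_product_3]) simp_all
  show "q \<le> 7 \<Longrightarrow> smooth_sum_bound q (18372 / 10000)"
    by (rule *[where k = 7, OF _ _ _ _ _ euler_product_5]) simp_all
  show "q \<le> 11 \<Longrightarrow> smooth_sum_bound q (21431 / 10000)"
    by (rule *[where k = 11, OF _ _ _ _ _ euler_product_7]) simp_all
  show "q \<le> 13 \<Longrightarrow> smooth_sum_bound q (23319 / 10000)"
    by (rule *[where k = 13, OF _ _ _ _ _ euler_product_11]) simp_all
  show "q \<le> 19 \<Longrightarrow> smooth_sum_bound q (26156 / 10000)"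
    by (rule *[where k = 19, OF _ _ _ _ _ euler_product_17]) simp_all
  show "q \<le> 61 \<Longrightarrow> smooth_sum_bound q (32038 / 10000)"
    by (rule *[where k = 61, OF _ _ _ _ _ euler_product_59]) simp_all
qed

section \<open>The total charge to a prime\<close>

lemma coprime_cofactor_ge:
  fixes c :: nat
  shows "coprime c 10 \<Longrightarrow> 10 \<le> c\<^sup>2 \<Longrightarrow> 7 \<le> c"
    and "coprime c 14 \<Longrightarrow> 14 \<le> c\<^sup>2 \<Longrightarrow> 5 \<le> c"
    and "coprime c 28 \<Longrightarrow> 28 \<le> c\<^sup>2 \<Longrightarrow> 9 \<le> c"
proof -
  have no: "\<not> p dvd c" if "coprime c k" "p dvd k" "p > 1" for k p
    using that by (metis coprime_common_divisor_nat less_irrefl)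
  have small: "c \<in> {0, 1, 2, 3, 4, 5, 6, 7, 8}" if "c < 9" using that by auto
  show "7 \<le> c" if "coprime c 10" "10 \<le> c\<^sup>2"
    using no[OF that(1), of 2] no[OF that(1), of 5] small that(2) by (cases "c < 9") auto
  show "5 \<le> c" if "coprime c 14" "14 \<le> c\<^sup>2"
    using no[OF that(1), of 2] small that(2) by (cases "c < 9") auto
  show "9 \<le> c" if "coprime c 28" "28 \<le> c\<^sup>2"
    using no[OF that(1), of 2] no[OF that(1), of 7] small that(2) by (cases "c < 9") auto
qed

lemma ratio_powr_le_neg_powr:
  assumes "q > 0" "m > 0" "m * q \<le> n"
  shows "(real q / real n) powr lam0 \<le> real m powr - lam0"
proof -
  have "real m * real q \<le> real n" using assms(3) by (metis of_nat_le_iff of_nat_mult)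
  moreover have "real n > 0" using calculation assms by (smt (verit) mult_pos_pos of_nat_0_less_iff)
  ultimately have "real q / real n \<le> 1 / real m" using assms by (simp add: field_simps)
  then have "(real q / real n) powr lam0 \<le> (1 / real m) powr lam0"
    by (intro powr_mono2) (auto simp: lam0_def)
  also have "\<dots> = real m powr - lam0" by (simp add: powr_minus_divide powr_divide)
  finally show ?thesis .
qed

text \<open>The ranges of q are chosen so that one Euler product serves each. Only q = 5 and q = 7
  need the small values of d treated separately; elsewhere S is empty.\<close>

lemma balanced_sum_with_square_le_1:
  assumes q: "prime q" "q > 2" and fin: "finite F" and inj: "inj_on \<delta> F"
    and F: "\<And>n. n \<in> F \<Longrightarrow> \<delta> n \<in> mixed_with_top q \<and> (\<exists>c. n = c * \<delta> n \<and> coprime c (\<delta> n) \<and> \<delta> n \<le> c\<^sup>2)"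
  shows "(\<Sum>n\<in>F. (real q / real n) powr lam0) + (1 / (2 * real q)) powr lam0 \<le> 1"
proof -
  have F': "\<delta> n \<in> mixed_with_top q \<and> (\<exists>c. n = c * \<delta> n \<and> \<delta> n \<le> c\<^sup>2)" if "n \<in> F" for n
    using F[OF that] by blast
  note sum_le = balanced_sum_le[OF q(1) fin inj _ F']
  have plain: ?thesis
    if "smooth_sum_bound q G"
      "real q powr (lam0 - s0) / (1 - real q powr - s0) * G + (1 / (2 * real q)) powr lam0 \<le> 1" for G
    using sum_le[OF that(1), of "{}" "\<lambda>_. 0"] that(2) by simp
  have "q = 3 \<or> q = 5 \<or> q = 7 \<or> q = 11 \<or> q = 13 \<or> (17 \<le> q \<and> q \<le> 19) \<or> (23 \<le> q \<and> q \<le> 61) \<or> 67 \<le> q"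
    using prime_less_67[OF q(1)] q(2) by (cases "q < 67") auto
  then consider "q = 3" | "q = 5" | "q = 7" | "q = 11" | "q = 13" | "17 \<le> q" "q \<le> 19"
    | "23 \<le> q" "q \<le> 61" | "67 \<le> q" by blast
  then show ?thesis
  proof cases
    case 1 then show ?thesis using plain[OF smooth_sum_bound_prime(1)] balanced_factor_3 by simp
  next
    case 4 then show ?thesis using plain[OF smooth_sum_bound_prime(4)] balanced_factor_11 by simp
  next
    case 5 then show ?thesis using plain[OF smooth_sum_bound_prime(5)] balanced_factor_13 by simp
  next
    case 6 then show ?thesis using plain[OF smooth_sum_bound_prime(6)] balanced_factor_17 by simp
  next
    case 7 then show ?thesis using plain[OF smooth_sum_bound_prime(7)] balanced_factor_23 by simp
  next
    case 8 then show ?thesis using plain[OF smooth_sum_bound_zeta] balanced_factor_67 by simp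
  next
    case 2
    have "(10::nat) \<in> mixed_with_top 5"
    proof -
      have "p \<le> 5" if "prime p" "p dvd 10" for p :: nat
      proof -
        have "p dvd 2 * 5" using that by simp
        then have "p dvd 2 \<or> p dvd 5" using that(1) prime_dvd_mult_iff by blast
        then show ?thesis by (auto dest: dvd_imp_le)
      qed
      then show ?thesis unfolding mixed_with_top_def by (auto intro!: exI[of _ 2])
    qed
    moreover have "(real q / real n) powr lam0 \<le> real 14 powr - lam0" if n: "n \<in> F" "\<delta> n \<in> {10}" for n
    proof -
      obtain c where c: "n = c * 10" "coprime c 10" "10 \<le> c\<^sup>2" using F[OF n(1)] n(2) by auto
      then show ?thesis using coprime_cofactor_ge(1)[of c] 2 by (intro ratio_powr_le_neg_powr) auto
    qed
    ultimately have "(\<Sum>n\<in>F. (real q / real n) powr lam0)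
       \<le> real q powr (lam0 - s0) / (1 - real q powr - s0) * (14241 / 10000)
         - (\<Sum>d\<in>{10}. real q powr lam0 * real d powr - s0 - real 14 powr - lam0)"
      using 2 smooth_sum_bound_prime(2)[of q] by (intro sum_le) auto
    then show ?thesis using 2 balanced_factor_5 saving_10 by simp
  next
    case 3
    have "{14, 28} \<subseteq> mixed_with_top 7"
    proof -
      have "p \<le> 7" if "prime p" "p dvd 28" for p :: nat
      proof -
        have "p dvd 2 * 2 * 7" using that by simp
        then have "p dvd 2 \<or> p dvd 7" using that(1) prime_dvd_mult_iff by blast
        then show ?thesis by (auto dest: dvd_imp_le)
      qed
      moreover have "p dvd 28" if "p dvd 14" for p :: nat using dvd_trans[OF that, of 28] by simp
      ultimately show ?thesis unfolding mixed_with_top_def by (auto intro!: exI[of _ 2])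
    qed
    moreover have "(real q / real n) powr lam0 \<le> real (if \<delta> n = 14 then 10 else 36) powr - lam0"
      if n: "n \<in> F" "\<delta> n \<in> {14, 28}" for n
    proof -
      obtain c where c: "n = c * \<delta> n" "coprime c (\<delta> n)" "\<delta> n \<le> c\<^sup>2" using F[OF n(1)] by auto
      then show ?thesis using n(2) coprime_cofactor_ge(2,3)[of c] 3 by (intro ratio_powr_le_neg_powr) auto
    qed
    ultimately have "(\<Sum>n\<in>F. (real q / real n) powr lam0)
       \<le> real q powr (lam0 - s0) / (1 - real q powr - s0) * (18372 / 10000)
         - (\<Sum>d\<in>{14, 28}. real q powr lam0 * real d powr - s0 - real (if d = 14 then 10 else 36) powr - lam0)"
      using 3 smooth_sum_bound_prime(3)[of q] by (intro sum_le) auto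
    then show ?thesis using 3 balanced_factor_7 saving_14 saving_28 by simp
  qed
qed

text \<open>\<open>F1\<close> holds the charges of the first kind, at most one, and
  \<open>F2\<close> the others. If both occur, the element a of \<open>F1\<close> is a multiple of
  q^2. Either a >= 2 q^2, which fits the reserved room, or a = q^2, which leaves a single element in
  \<open>F2\<close>.\<close>

lemma charge_sum_le_1:
  assumes A: "two_primitive A" and q: "prime q" and fin: "finite F" and FA: "F \<subseteq> A"
    and F: "\<And>n. n \<in> F \<Longrightarrow> q dvd n \<and>
              (private_divisor A n (q ^ multiplicity q n) \<or> (\<exists>d. balanced_charge A q n d))"
  shows "(\<Sum>n\<in>F. (real q / real n) powr lam0) \<le> 1"
proof -
  define F1 where "F1 = {n \<in> F. private_divisor A n (q ^ multiplicity q n)}"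
  define F2 where "F2 = F - F1"
  have pos: "n > 0" if "n \<in> F" for n
  proof -
    have "1 < n" using that FA A unfolding two_primitive_def by blast
    then show ?thesis by simp
  qed
  have q0: "q > 0" using q prime_gt_0_nat by blast
  have fin12: "finite F1" "finite F2" using fin by (auto simp: F1_def F2_def)
  have split: "(\<Sum>n\<in>F. (real q / real n) powr lam0)
      = (\<Sum>n\<in>F1. (real q / real n) powr lam0) + (\<Sum>n\<in>F2. (real q / real n) powr lam0)"
    using fin by (subst sum.subset_diff[of F1 F]) (auto simp: F1_def F2_def)
  \<comment> \<open>Powers of the same prime q are nested under divisibility, so two of them cannot
    be private to different elements.\<close>
  have uniq: "n = m" if nm: "n \<in> F1" "m \<in> F1" for n m
  proof (rule ccontr)
    assume "n \<noteq> m"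
    then have "\<not> q ^ multiplicity q n dvd m" "\<not> q ^ multiplicity q m dvd n"
      using nm FA by (auto simp: F1_def private_divisor_def)
    moreover have "multiplicity q n \<le> multiplicity q m \<or> multiplicity q m \<le> multiplicity q n" by linarith
    ultimately show False by (meson multiplicity_dvd')
  qed
  have "\<forall>n\<in>F2. \<exists>d. balanced_charge A q n d" using F by (auto simp: F1_def F2_def)
  then obtain \<delta> where \<delta>: "\<And>n. n \<in> F2 \<Longrightarrow> balanced_charge A q n (\<delta> n)" by metis
  have inj: "inj_on \<delta> F2"
  proof (rule inj_onI)
    fix n m assume nm: "n \<in> F2" "m \<in> F2" "\<delta> n = \<delta> m"
    then have "\<delta> n dvd m" using \<delta>[of m] by (auto simp: balanced_charge_def private_divisor_def)
    moreover have "m \<in> A" using nm FA by (auto simp: F2_def)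
    moreover have "private_divisor A n (\<delta> n)" using \<delta>[of n] nm by (simp add: balanced_charge_def)
    ultimately show "n = m" unfolding private_divisor_def by metis
  qed
  have key: "(\<Sum>n\<in>F2. (real q / real n) powr lam0) + (1 / (2 * real q)) powr lam0 \<le> 1" if "q > 2"
    using \<delta> by (intro balanced_sum_with_square_le_1[OF q that fin12(2) inj]) (auto simp: balanced_charge_def)
  show ?thesis
  proof (cases "F2 = {}")
    case True
    show ?thesis
    proof (cases "F1 = {}")
      case False
      then obtain a where a: "F1 = {a}" using uniq by blast
      then have "a \<in> F" by (auto simp: F1_def)
      then have "q \<le> a" using F[of a] pos[of a] by (auto intro: dvd_imp_le)
      then have "(real q / real a) powr lam0 \<le> 1" using ratio_powr_le_neg_powr[of q 1 a] q0 by simp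
      then show ?thesis using split True a by simp
    qed (use split True in simp)
  next
    case False
    then obtain b where b: "b \<in> F2" by blast
    have bF: "b \<in> F" "b \<notin> F1" using b by (auto simp: F2_def)
    have db: "\<delta> b \<in> mixed_with_top q" using \<delta>[OF b] by (simp add: balanced_charge_def)
    obtain p where p: "p < q" "prime p" "p dvd \<delta> b" using db by (auto simp: mixed_with_top_def)
    have q2: "q > 2" using p prime_ge_2_nat[of p] by simp
    show ?thesis
    proof (cases "F1 = {}")
      case True
      then show ?thesis using split key[OF q2] by (smt (verit) powr_ge_zero sum.empty)
    next
      case False
      then obtain a where a: "F1 = {a}" using uniq by blast
      then have aF: "a \<in> F" "private_divisor A a (q ^ multiplicity q a)" by (auto simp: F1_def)
      have ab: "a \<noteq> b" using a bF by auto
      have nd: "\<not> q ^ multiplicity q a dvd b" using aF ab bF FA by (auto simp: private_divisor_def)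
      \<comment> \<open>As q divides b, exponent 0 or 1 would make the private power of a divide
        b.\<close>
      have "multiplicity q a \<ge> 2"
      proof (rule ccontr)
        assume "\<not> ?thesis"
        then have "multiplicity q a = 0 \<or> multiplicity q a = 1" by auto
        then show False using nd F[OF bF(1)] by auto
      qed
      then have "q\<^sup>2 dvd a" by (rule multiplicity_dvd')
      then obtain k where k: "a = q\<^sup>2 * k" by blast
      have k0: "k > 0" using k pos[OF aF(1)] by (auto intro!: Nat.gr0I)
      show ?thesis
      proof (cases "k = 1")
        case False
        then have "(2 * q) * q \<le> a" using k k0 by (simp add: power2_eq_square)
        then have "(real q / real a) powr lam0 \<le> real (2 * q) powr - lam0"
          using q0 by (intro ratio_powr_le_neg_powr) auto
        also have "\<dots> = (1 / (2 * real q)) powr lam0" using q0 by (simp add: powr_minus_divide powr_divide)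
        finally show ?thesis using split a key[OF q2] by simp
      next
        case True
        \<comment> \<open>Two distinct elements of \<open>F2\<close> are both multiples of q, so
          their product would be divisible by a = q^2.\<close>
        have "c = b" if c: "c \<in> F2" for c
        proof (rule ccontr)
          assume "c \<noteq> b"
          have cF: "c \<in> F" "c \<noteq> a" using c a by (auto simp: F2_def)
          have "a dvd b * c" using k True F[OF bF(1)] F[OF cF(1)]
            by (simp add: power2_eq_square mult_dvd_mono)
          moreover have "\<not> a dvd b * c"
            using A aF(1) bF(1) cF FA ab \<open>c \<noteq> b\<close> unfolding two_primitive_def by (metis subsetD)
          ultimately show False by blast
        qed
        then have F2: "F2 = {b}" using b by blast
        obtain c where c: "b = c * \<delta> b" "coprime c (\<delta> b)" "\<delta> b \<le> c\<^sup>2"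
          using \<delta>[OF b] by (auto simp: balanced_charge_def)
        have d: "q dvd \<delta> b" "\<delta> b > 0" using db by (auto simp: mixed_with_top_def)
        then obtain m where m: "\<delta> b = q * m" by blast
        have "p dvd m"
          using p q m by (metis prime_dvd_mult_iff primes_dvd_imp_eq less_irrefl)
        moreover have "m > 0" using m d(2) by (cases m) auto
        ultimately have m2: "m \<ge> 2" using p(2) by (meson dvd_imp_le order_trans prime_ge_2_nat)
        have "2 * 2 \<le> q * m" using m2 q2 by (intro mult_le_mono) auto
        then have "2\<^sup>2 \<le> c\<^sup>2" using c(3) m by simp
        then have c2: "c \<ge> 2" by (rule power2_le_imp_le) simp
        \<comment> \<open>The cofactor c is coprime to q m, so it differs from m; two distinct
          integers that are at least 2 have product at least 6.\<close>
        have "c \<noteq> m"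
          using c(2) m m2 by (metis coprime_mult_right_iff coprime_self nat_dvd_1_iff_1 numeral_le_one_iff semiring_norm(69))
        then have "(2 \<le> c \<and> 3 \<le> m) \<or> (3 \<le> c \<and> 2 \<le> m)" using c2 m2 by linarith
        then have "6 \<le> c * m" using mult_le_mono[of 2 c 3 m] mult_le_mono[of 3 c 2 m] by auto
        then have "6 * q \<le> b" using c(1) m by (simp add: mult.commute mult.left_commute)
        then have "(real q / real b) powr lam0 \<le> 6 powr - lam0"
          using ratio_powr_le_neg_powr[of q 6 b] q0 by simp
        moreover have "(real q / real a) powr lam0 \<le> 3 powr - lam0"
          using ratio_powr_le_neg_powr[of q 3 a] q0 q2 k True by (simp add: power2_eq_square)
        ultimately show ?thesis using split a F2 three_six_powr_le_1 by simp
      qed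
    qed
  qed
qed

section \<open>Summing the charges over all primes\<close>

theorem theorem1p5:
  fixes lam x :: real and A :: "nat set"
  assumes "lam \<ge> 0.7983" and "x \<ge> 2" and "two_primitive A"
  shows "(\<Sum>n | n \<in> A \<and> real n \<le> x. 1 / real n powr lam)
       \<le> (\<Sum>p | p \<in> primes_dividing A \<and> real p \<le> x. 1 / real p powr lam)"
proof -
  define N where "N = {n. n \<in> A \<and> real n \<le> x}"
  define P where "P = {p. p \<in> primes_dividing A \<and> real p \<le> x}"
  have fin: "finite N" "finite P"
    by (rule finite_subset[of _ "{..nat \<lfloor>x\<rfloor>}"]; force simp: N_def P_def le_nat_floor)+
  obtain \<phi> where \<phi>: "\<And>n. n \<in> A \<Longrightarrow> prime (\<phi> n) \<and> \<phi> n dvd n \<and>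
      (private_divisor A n (\<phi> n ^ multiplicity (\<phi> n) n) \<or> (\<exists>d. balanced_charge A (\<phi> n) n d))"
    using exists_charged_prime[OF assms(3)] by metis
  have pos: "n > 0" if "n \<in> A" for n using that assms(3) by (auto simp: two_primitive_def)
  have le: "\<phi> n \<le> n" if "n \<in> A" for n using \<phi>[OF that] pos[OF that] by (auto intro: dvd_imp_le)
  \<comment> \<open>The charged prime divides n, so it is at most n and survives the cutoff at
    x.\<close>
  have sub: "\<phi> ` N \<subseteq> P"
  proof (rule image_subsetI)
    fix n assume "n \<in> N"
    then have n: "n \<in> A" "real n \<le> x" by (auto simp: N_def)
    moreover have "real (\<phi> n) \<le> real n" using le[OF n(1)] by simp
    ultimately show "\<phi> n \<in> P" using \<phi>[OF n(1)] by (auto simp: P_def primes_dividing_def)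
  qed
  have "(\<Sum>n\<in>N. 1 / real n powr lam) = (\<Sum>q\<in>P. \<Sum>n | n \<in> N \<and> \<phi> n = q. 1 / real n powr lam)"
    using sum.group[OF fin sub, of "\<lambda>n. 1 / real n powr lam"] by simp
  also have "\<dots> \<le> (\<Sum>q\<in>P. 1 / real q powr lam)"
  proof (rule sum_mono)
    fix q assume "q \<in> P"
    then have q: "prime q" by (auto simp: P_def primes_dividing_def)
    then have q0: "real q > 0" using prime_gt_0_nat by auto
    let ?F = "{n. n \<in> N \<and> \<phi> n = q}"
    have finF: "finite ?F" using fin by simp
    \<comment> \<open>Normalising by q powr -lam leaves ratios q / n <= 1, whose powers decrease in
      the exponent; hence the single exponent \<open>lam0\<close> <= 0.7983 settles every
      lam.\<close>
    have "(\<Sum>n\<in>?F. 1 / real n powr lam) \<le> (\<Sum>n\<in>?F. 1 / real q powr lam * (real q / real n) powr lam0)"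
    proof (rule sum_mono)
      fix n assume n: "n \<in> ?F"
      then have nA: "n \<in> A" by (simp add: N_def)
      have qn: "real q \<le> real n" using le[OF nA] n by simp
      have "1 / real n powr lam = 1 / real q powr lam * (real q / real n) powr lam"
        using q0 by (simp add: powr_divide)
      also have "\<dots> \<le> 1 / real q powr lam * (real q / real n) powr lam0"
        using assms(1) q0 qn by (intro mult_left_mono powr_mono') (auto simp: lam0_def)
      finally show "1 / real n powr lam \<le> 1 / real q powr lam * (real q / real n) powr lam0" .
    qed
    also have "\<dots> = 1 / real q powr lam * (\<Sum>n\<in>?F. (real q / real n) powr lam0)"
      by (simp add: sum_distrib_left)
    also have "\<dots> \<le> 1 / real q powr lam * 1"
      using \<phi> by (intro mult_left_mono charge_sum_le_1[OF assms(3) q finF]) (auto simp: N_def)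
    finally show "(\<Sum>n\<in>?F. 1 / real n powr lam) \<le> 1 / real q powr lam" by simp
  qed
  finally show ?thesis unfolding N_def P_def .
qed

end
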